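(* Let $N\ge 4$, let $\mu_1,\dots,\mu_N\in\mathbf{C}$ be distinct, and let $X=Q\cap Q_1\subset \mathrm{P}^{N-1}$ be the smooth $n$-dimensional intersection ($n=N-3$) of the quadrics $Q=\{\sum_{i=1}^N x_i^2=0\}$ and $Q_1=\{\sum_{i=1}^N\mu_i x_i^2=0\}$. A point $(x_1,\dots,x_N)\in X$ is very stable with respect to the integrable system on $T^*X$ generated by the functions $$f_i=\sum_{j\neq i}\frac{(x_iy_j-x_jy_i)^2}{\mu_i-\mu_j},\qquad 1\le i\le N,$$ if and only if the polynomial $$p(z)=\sum_{i=1}^N x_i^2\,(z-\mu_1)(z-\mu_2)\cdots\widehat{(z-\mu_i)}\cdots(z-\mu_N)$$ (the hat denotes omission of the factor) has distinct roots, where roots at $z=\infty$ are included, i.e. $p$ is regarded as a polynomial of degree at most $n=N-3$, equivalently as a section of $\mathcal{O}(n)$ on $\mathrm{P}^1$ with $n$ zeros counted with multiplicity.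
   Context: For a point of $X$ with homogeneous coordinates $x=(x_1,\dots,x_N)$, cotangent vectors of $X$ at that point are represented by $y=(y_1,\dots,y_N)\in\mathbf{C}^N$ with $\sum_i x_iy_i=0$, modulo the span of the vectors $(x_1,\dots,x_N)$ and $(\mu_1x_1,\dots,\mu_Nx_N)$ (rescaling $x\mapsto\lambda x$ is accompanied by $y\mapsto\lambda^{-1}y$). The functions $f_i$ are the quadratic functions on $T^*X$ corresponding to the symmetric tensors $s_i=\sum_{j\ne i}\frac{(x_i\partial_j-x_j\partial_i)^2}{\mu_i-\mu_j}$, which are well defined as sections of $S^2TX$ on $X$. The functions $f_i$ Poisson-commute and span an $n$-dimensional space of functions, defining an integrable system on $T^*X$. A point of $X$ is called very stable (with respect to the integrable system) if there is no non-zero cotangent vector of $X$ at that point on which all the functions $f_1,\dots,f_N$ vanish. Because $\sum_i x_i^2=0=\sum_i\mu_ix_i^2$ on $X$, the coefficients of $z^{N-1}$ and $z^{N-2}$ in $p(z)$ vanish, so $p$ has degree at most $n=N-3$; a drop in degree by $m$ is counted as a root of multiplicity $m$ at $z=\infty$. *)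

theory Defs
  imports "HOL-Analysis.Cartesian_Space" "HOL-Computational_Algebra.Polynomial"
begin

(* Points of projective space are given by homogeneous coordinates: the set below is the
   affine cone over the intersection of the two quadrics, without the origin. *)
definition quadric_intersection :: "('n::finite \<Rightarrow> complex) \<Rightarrow> (complex ^ 'n) set" where
  "quadric_intersection \<mu> =
     {x. x \<noteq> 0 \<and> (\<Sum>i\<in>UNIV. (x $ i)^2) = 0 \<and> (\<Sum>i\<in>UNIV. \<mu> i * (x $ i)^2) = 0}"

(* The cotangent space at x is the quotient of cotangent_reps x by cotangent_null \<mu> x.
   vec.span is the span over the complex numbers (plain span would be the real one). *)
definition cotangent_reps :: "complex ^ 'n \<Rightarrow> (complex ^ 'n::finite) set" where
  "cotangent_reps x = {y. (\<Sum>i\<in>UNIV. x $ i * y $ i) = 0}"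

definition cotangent_null :: "('n::finite \<Rightarrow> complex) \<Rightarrow> complex ^ 'n \<Rightarrow> (complex ^ 'n) set" where
  "cotangent_null \<mu> x = vec.span {x, \<chi> i. \<mu> i * x $ i}"

definition hamiltonian ::
  "('n::finite \<Rightarrow> complex) \<Rightarrow> 'n \<Rightarrow> complex ^ 'n \<Rightarrow> complex ^ 'n \<Rightarrow> complex" where
  "hamiltonian \<mu> i x y =
     (\<Sum>j\<in>UNIV - {i}. (x $ i * y $ j - x $ j * y $ i)^2 / (\<mu> i - \<mu> j))"

definition very_stable :: "('n::finite \<Rightarrow> complex) \<Rightarrow> complex ^ 'n \<Rightarrow> bool" where
  "very_stable \<mu> x \<longleftrightarrow>
     \<not> (\<exists>y \<in> cotangent_reps x. y \<notin> cotangent_null \<mu> x \<and> (\<forall>i. hamiltonian \<mu> i x y = 0))"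

definition point_poly :: "('n::finite \<Rightarrow> complex) \<Rightarrow> complex ^ 'n \<Rightarrow> complex poly" where
  "point_poly \<mu> x = (\<Sum>i\<in>UNIV. smult ((x $ i)^2) (\<Prod>j\<in>UNIV - {i}. [:- \<mu> j, 1:]))"

(* Multiplicity of a zero on the projective line of a nonzero p of degree at most n, regarded
   as a section of O(n); None is the point at infinity. *)
definition zero_mult :: "nat \<Rightarrow> complex poly \<Rightarrow> complex option \<Rightarrow> nat" where
  "zero_mult n p w = (case w of Some z \<Rightarrow> order z p | None \<Rightarrow> n - degree p)"

definition distinct_roots_P1 :: "nat \<Rightarrow> complex poly \<Rightarrow> bool" where
  "distinct_roots_P1 n p \<longleftrightarrow> p \<noteq> 0 \<and> degree p \<le> n \<and> (\<forall>w. zero_mult n p w \<le> 1)"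

lemma cotangent_null_iff:
  "v \<in> cotangent_null \<mu> x \<longleftrightarrow> (\<exists>a b. v = (\<chi> i. (a + b * \<mu> i) * x $ i))"
proof -
  have "v \<in> cotangent_null \<mu> x \<longleftrightarrow> (\<exists>a b. v - a *s x = b *s (\<chi> i. \<mu> i * x $ i))"
    unfolding cotangent_null_def
    by (simp add: vec.span_insert[of x] vec.span_singleton) blast
  also have "\<dots> \<longleftrightarrow> (\<exists>a b. v = (\<chi> i. (a + b * \<mu> i) * x $ i))"
    by (simp add: vec_eq_iff algebra_simps)
  finally show ?thesis .
qed

(* The quotient makes sense and the quadratic functions descend to it. *)
lemma cotangent_null_subset_reps:
  assumes "x \<in> quadric_intersection \<mu>"
  shows "cotangent_null \<mu> x \<subseteq> cotangent_reps x"
proof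
  fix v assume "v \<in> cotangent_null \<mu> x"
  then obtain a b where v: "v = (\<chi> i. (a + b * \<mu> i) * x $ i)"
    by (auto simp: cotangent_null_iff)
  have "(\<Sum>i\<in>UNIV. x $ i * v $ i)
      = (\<Sum>i\<in>UNIV. a * (x $ i)^2 + b * (\<mu> i * (x $ i)^2))"
    by (rule sum.cong) (auto simp: v algebra_simps power2_eq_square)
  also have "\<dots> = a * (\<Sum>i\<in>UNIV. (x $ i)^2) + b * (\<Sum>i\<in>UNIV. \<mu> i * (x $ i)^2)"
    by (simp add: sum.distrib sum_distrib_left)
  also have "\<dots> = 0"
    using assms by (simp add: quadric_intersection_def)
  finally show "v \<in> cotangent_reps x"
    by (simp add: cotangent_reps_def)
qed

lemma hamiltonian_well_defined:
  assumes "inj \<mu>" "x \<in> quadric_intersection \<mu>" "y \<in> cotangent_reps x"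
    and "v \<in> cotangent_null \<mu> x"
  shows "hamiltonian \<mu> i x (y + v) = hamiltonian \<mu> i x y"
proof -
  obtain a b where v: "v = (\<chi> i. (a + b * \<mu> i) * x $ i)"
    using assms(4) by (auto simp: cotangent_null_iff)
  define d where "d j = 2 * b * (x $ i * y $ i * (x $ j)^2 - (x $ i)^2 * (x $ j * y $ j))
      + b^2 * (x $ i)^2 * (\<mu> i * (x $ j)^2 - \<mu> j * (x $ j)^2)" for j
  have step: "(x $ i * (y + v) $ j - x $ j * (y + v) $ i)^2 / (\<mu> i - \<mu> j)
      = (x $ i * y $ j - x $ j * y $ i)^2 / (\<mu> i - \<mu> j) + d j" if "j \<noteq> i" for j
  proof -
    have ne: "\<mu> i - \<mu> j \<noteq> 0"
      using that assms(1) by (auto dest: injD)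
    have "(x $ i * (y + v) $ j - x $ j * (y + v) $ i)^2
        = (x $ i * y $ j - x $ j * y $ i)^2 + d j * (\<mu> i - \<mu> j)"
      unfolding v d_def by simp algebra
    with ne show ?thesis
      by (simp add: field_simps)
  qed
  have "hamiltonian \<mu> i x (y + v) = hamiltonian \<mu> i x y + (\<Sum>j\<in>UNIV - {i}. d j)"
    unfolding hamiltonian_def sum.distrib[symmetric] by (rule sum.cong) (use step in auto)
  also have "(\<Sum>j\<in>UNIV - {i}. d j) = (\<Sum>j\<in>UNIV. d j)"
    by (rule sum.mono_neutral_left) (auto simp: d_def power2_eq_square)
  also have "\<dots> = 2 * b * (x $ i * y $ i * (\<Sum>j\<in>UNIV. (x $ j)^2)
        - (x $ i)^2 * (\<Sum>j\<in>UNIV. x $ j * y $ j))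
      + b^2 * (x $ i)^2 * (\<mu> i * (\<Sum>j\<in>UNIV. (x $ j)^2) - (\<Sum>j\<in>UNIV. \<mu> j * (x $ j)^2))"
    unfolding d_def by (simp only: sum.distrib sum_subtractf sum_distrib_left[symmetric])
  also have "\<dots> = 0"
    using assms(2,3) by (simp add: quadric_intersection_def cotangent_reps_def)
  finally show ?thesis by simp
qed

lemma hamiltonian_rescale:
  assumes "c \<noteq> 0"
  shows "hamiltonian \<mu> i (c *s x) (inverse c *s y) = hamiltonian \<mu> i x y"
  using assms by (simp add: hamiltonian_def field_simps)

end

theory Submission
  imports Defs "HOL-Computational_Algebra.Fundamental_Theorem_Algebra"
begin

text \<open>
  Let \<open>N\<close> be the number of coordinates, \<open>D = \<Prod>i. (z - \<mu> i)\<close>, and put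
  \<open>A = \<Sum>i. (x i)\<^sup>2 / (z - \<mu> i)\<close>, \<open>B = \<Sum>i. x i * y i / (z - \<mu> i)\<close>,
  \<open>C = \<Sum>i. (y i)\<^sup>2 / (z - \<mu> i)\<close>.  The Hamiltonians are the residues of
  \<open>A * C - B\<^sup>2\<close> (\<open>hamiltonian_generating_function\<close>), so they all vanish exactly when
  \<open>A * C = B\<^sup>2\<close>.  After multiplication by \<open>D\<^sup>2\<close> this reads \<open>p * r = q\<^sup>2\<close> for polynomials
  \<open>p = D * A\<close>, the polynomial of the point, \<open>q = D * B\<close> and \<open>r = D * C\<close>.

  If \<open>p\<close> has distinct roots, it divides \<open>q\<close>, so \<open>q = p * g\<close> and \<open>r = p * g\<^sup>2\<close>.  The degree of \<open>r\<close>
  forces \<open>g = a + b * z\<close>, and evaluation at the nodes \<open>\<mu> i\<close> gives \<open>y i = (a + b * \<mu> i) * x i\<close>: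
  the cotangent vector is zero (\<open>distinct_roots_imp_null\<close>).

  Conversely, \<open>p * r = q\<^sup>2\<close> also holds with \<open>q = p / (z - z0)\<close> and \<open>r = p / (z - z0)\<^sup>2\<close> if \<open>z0\<close> is a
  double root of \<open>p\<close>, and with \<open>q = z\<^sup>2 * p\<close> and \<open>r = z\<^sup>4 * p\<close> if \<open>p\<close> has a double root at infinity.
  Reading off the values at the nodes suggests the vectors \<open>y\<close> in
  \<open>double_root_imp_not_very_stable\<close> and \<open>double_root_at_infinity_imp_not_very_stable\<close>.  There the
  conditions on \<open>y\<close> are checked directly: each of them is an instance of the identity
  \<open>\<Sum>i. h (\<mu> i) / D' (\<mu> i) = 0\<close> for polynomials \<open>h\<close> of degree less than \<open>N - 1\<close>
  (\<open>sum_values_over_node_weights\<close>).  These \<open>y\<close> are not null because a non-zero multiplier of degree at most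
  two in \<open>\<mu> i\<close> cannot annihilate a point of the intersection (\<open>quadratic_multiplier_zero\<close>).
\<close>

section \<open>Polynomials with prescribed values at the nodes\<close>

definition node_poly :: "('n::finite \<Rightarrow> 'a::field) \<Rightarrow> 'a poly" where
  "node_poly \<mu> = (\<Prod>j\<in>UNIV. [:- \<mu> j, 1:])"

text \<open>The derivative of the node polynomial at the node \<open>\<mu> i\<close>.\<close>
definition node_weight :: "('n::finite \<Rightarrow> 'a::field) \<Rightarrow> 'n \<Rightarrow> 'a" where
  "node_weight \<mu> i = (\<Prod>j\<in>UNIV - {i}. \<mu> i - \<mu> j)"

text \<open>
  This is the product of the node polynomial with the partial fraction \<open>\<Sum>i. c i / (z - \<mu> i)\<close>, in a
  form that also makes sense at the nodes.
\<close>
definition lagrange_comb :: "('n::finite \<Rightarrow> 'a::field) \<Rightarrow> ('n \<Rightarrow> 'a) \<Rightarrow> 'a poly" where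
  "lagrange_comb \<mu> c = (\<Sum>i\<in>UNIV. smult (c i) (\<Prod>j\<in>UNIV - {i}. [:- \<mu> j, 1:]))"

lemma node_weight_nonzero: "inj \<mu> \<Longrightarrow> node_weight \<mu> i \<noteq> 0"
  by (auto simp: node_weight_def dest: injD)

lemma degree_node_poly: "degree (node_poly (\<mu> :: 'n::finite \<Rightarrow> 'a::field)) = CARD('n)"
  by (simp add: node_poly_def degree_prod_sum_eq)

lemma node_poly_remove: "node_poly \<mu> = [:- \<mu> i, 1:] * (\<Prod>j\<in>UNIV - {i}. [:- \<mu> j, 1:])"
  unfolding node_poly_def by (rule prod.remove) auto

lemma poly_lagrange_comb_node: "poly (lagrange_comb \<mu> c) (\<mu> i) = c i * node_weight \<mu> i"
proof -
  have "poly (lagrange_comb \<mu> c) (\<mu> i) = (\<Sum>k\<in>UNIV. c k * (\<Prod>j\<in>UNIV - {k}. \<mu> i - \<mu> j))"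
    by (simp add: lagrange_comb_def poly_sum poly_prod)
  also have "\<dots> = (\<Sum>k\<in>UNIV. if k = i then c i * node_weight \<mu> i else 0)"
    by (intro sum.cong) (auto simp: node_weight_def)
  finally show ?thesis by simp
qed

lemma poly_lagrange_comb_off_nodes:
  assumes "z \<notin> range \<mu>"
  shows "poly (lagrange_comb \<mu> c) z = poly (node_poly \<mu>) z * (\<Sum>i\<in>UNIV. c i / (z - \<mu> i))"
proof -
  have "c i * (\<Prod>j\<in>UNIV - {i}. z - \<mu> j) = poly (node_poly \<mu>) z * (c i / (z - \<mu> i))" for i
  proof -
    have "z - \<mu> i \<noteq> 0" using assms by auto
    thus ?thesis by (simp add: node_poly_remove[of \<mu> i] poly_prod field_simps)
  qed
  thus ?thesis
    by (simp add: lagrange_comb_def poly_sum poly_prod sum_distrib_left)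
qed

lemma degree_lagrange_comb:
  "degree (lagrange_comb (\<mu> :: 'n::finite \<Rightarrow> 'a::field) c) \<le> CARD('n) - 1"
  unfolding lagrange_comb_def
  by (intro degree_sum_le order.trans[OF degree_smult_le])
     (auto simp: degree_prod_sum_eq card_Diff_singleton)

text \<open>
  Write \<open>z = (z - \<mu> i) + \<mu> i\<close> in the \<open>i\<close>-th summand.  So multiplication by \<open>z\<close> acts on the
  coefficients \<open>c\<close> as multiplication by \<open>\<mu>\<close>, up to a multiple of the node polynomial which
  records the top coefficient; this is what turns moment conditions on \<open>c\<close> into degree bounds.
\<close>
lemma lagrange_comb_shift:
  "[:0, 1:] * lagrange_comb \<mu> c =
     lagrange_comb \<mu> (\<lambda>i. \<mu> i * c i) + smult (\<Sum>i\<in>UNIV. c i) (node_poly \<mu>)"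
proof -
  have "[:0, 1:] * smult (c i) (\<Prod>j\<in>UNIV - {i}. [:- \<mu> j, 1:])
      = smult (\<mu> i * c i) (\<Prod>j\<in>UNIV - {i}. [:- \<mu> j, 1:]) + smult (c i) (node_poly \<mu>)" for i
    by (simp add: node_poly_remove[of \<mu> i] smult_diff_right mult.commute)
  thus ?thesis
    by (simp only: lagrange_comb_def sum_distrib_left sum.distrib smult_sum)
qed

lemma degree_lagrange_comb_moments:
  fixes \<mu> :: "'n::finite \<Rightarrow> 'a::field"
  assumes "(\<Sum>i\<in>UNIV. c i) = 0" and "(\<Sum>i\<in>UNIV. \<mu> i * c i) = 0"
  shows "degree (lagrange_comb \<mu> c) \<le> CARD('n) - 3"
proof -
  \<comment> \<open>Each vanishing moment lowers the degree by one.\<close>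
  have drop: "degree (lagrange_comb \<mu> d) \<le> m - 1"
    if "(\<Sum>i\<in>UNIV. d i) = 0" "degree (lagrange_comb \<mu> (\<lambda>i. \<mu> i * d i)) \<le> m" for d m
  proof (cases "lagrange_comb \<mu> d = 0")
    case False
    have "pCons 0 (lagrange_comb \<mu> d) = lagrange_comb \<mu> (\<lambda>i. \<mu> i * d i)"
      using lagrange_comb_shift[of \<mu> d] that(1) by simp
    hence "degree (pCons 0 (lagrange_comb \<mu> d)) \<le> m" using that(2) by simp
    thus ?thesis using False by simp
  qed simp
  from drop[OF assms(1) drop[OF assms(2) degree_lagrange_comb]] show ?thesis by simp
qed

text \<open>
  Interpolation at \<open>N\<close> nodes recovers every polynomial of degree below \<open>N\<close>; the sum in question
  is its coefficient of \<open>z ^ (N - 1)\<close>.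
\<close>
lemma sum_values_over_node_weights:
  fixes \<mu> :: "'n::finite \<Rightarrow> 'a::field"
  assumes "inj \<mu>" and "degree h + 1 < CARD('n)"
  shows "(\<Sum>i\<in>UNIV. poly h (\<mu> i) / node_weight \<mu> i) = 0"
proof (rule ccontr)
  define c where "c i = poly h (\<mu> i) / node_weight \<mu> i" for i
  assume nz: "(\<Sum>i\<in>UNIV. poly h (\<mu> i) / node_weight \<mu> i) \<noteq> 0"
  have N: "CARD('n) \<noteq> 0" by simp
  have card: "card (range \<mu>) = CARD('n)" using assms(1) by (simp add: card_image)
  have "lagrange_comb \<mu> c = h"
  proof (rule poly_eqI_degree[where A = "range \<mu>"])
    show "poly (lagrange_comb \<mu> c) z = poly h z" if "z \<in> range \<mu>" for z
      using that node_weight_nonzero[OF assms(1)] by (auto simp: poly_lagrange_comb_node c_def)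
  qed (use card assms(2) degree_lagrange_comb[of \<mu> c] N in linarith)+
  hence "smult (\<Sum>i\<in>UNIV. c i) (node_poly \<mu>) = pCons 0 h - lagrange_comb \<mu> (\<lambda>i. \<mu> i * c i)"
    using lagrange_comb_shift[of \<mu> c] by (simp add: algebra_simps)
  moreover have "degree (pCons 0 h - lagrange_comb \<mu> (\<lambda>i. \<mu> i * c i)) < CARD('n)"
    using assms(2) degree_lagrange_comb[of \<mu> "\<lambda>i. \<mu> i * c i"] N
    by (intro degree_diff_less) auto
  moreover have "degree (smult (\<Sum>i\<in>UNIV. c i) (node_poly \<mu>)) = CARD('n)"
    using nz by (simp add: c_def degree_node_poly)
  ultimately show False by simp
qed

section \<open>The polynomial of a point\<close>

lemma point_poly_eq: "point_poly \<mu> x = lagrange_comb \<mu> (\<lambda>i. (x $ i)\<^sup>2)"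
  by (simp add: point_poly_def lagrange_comb_def)

lemma poly_point_poly_node: "poly (point_poly \<mu> x) (\<mu> i) = (x $ i)\<^sup>2 * node_weight \<mu> i"
  by (simp add: point_poly_eq poly_lagrange_comb_node)

lemma degree_point_poly:
  fixes \<mu> :: "'n::finite \<Rightarrow> complex"
  assumes "x \<in> quadric_intersection \<mu>"
  shows "degree (point_poly \<mu> x) \<le> CARD('n) - 3"
  unfolding point_poly_eq
  using assms by (intro degree_lagrange_comb_moments) (auto simp: quadric_intersection_def)

lemma point_poly_nonzero:
  assumes "inj \<mu>" and "x \<in> quadric_intersection \<mu>"
  shows "point_poly \<mu> x \<noteq> 0"
proof
  assume "point_poly \<mu> x = 0"
  hence "x $ i = 0" for i
    using poly_point_poly_node[of \<mu> x i] node_weight_nonzero[OF assms(1), of i] by simp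
  thus False using assms(2) by (auto simp: quadric_intersection_def vec_eq_iff)
qed

text \<open>
  If \<open>p\<close> is the polynomial of the point, \<open>p * g\<close> has degree less than \<open>N\<close> and vanishes at all \<open>N\<close>
  nodes.  Equivalently, a point of the intersection has at least three non-zero coordinates.  A
  cotangent vector is shown to be non-zero by means of such a multiplier \<open>g\<close>.
\<close>
lemma quadratic_multiplier_zero:
  fixes \<mu> :: "'n::finite \<Rightarrow> complex"
  assumes "CARD('n) \<ge> 4" and "inj \<mu>" and x: "x \<in> quadric_intersection \<mu>"
    and g: "degree g \<le> 2" and zero: "\<And>i. poly g (\<mu> i) * x $ i = 0"
  shows "g = 0"
proof -
  have card: "card (range \<mu>) = CARD('n)" using assms(2) by (simp add: card_image)
  have "point_poly \<mu> x * g = 0"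
  proof (rule poly_eqI_degree[where A = "range \<mu>"])
    show "poly (point_poly \<mu> x * g) z = poly 0 z" if z: "z \<in> range \<mu>" for z
    proof -
      obtain i where "z = \<mu> i" using z by auto
      thus ?thesis using zero[of i] by (auto simp: poly_point_poly_node)
    qed
    show "degree (point_poly \<mu> x * g) < card (range \<mu>)"
      using degree_mult_le[of "point_poly \<mu> x" g] degree_point_poly[OF x] g assms(1)
      unfolding card by linarith
  qed (use card in simp)
  thus ?thesis using point_poly_nonzero[OF assms(2) x] by simp
qed

section \<open>The Hamiltonians as one quadratic equation\<close>

text \<open>
  The numerator \<open>(x i * y j - x j * y i)\<^sup>2\<close> is symmetric in \<open>i, j\<close>, so symmetrising the
  double sum for \<open>A * C - B\<^sup>2\<close> and splitting \<open>1 / ((z - \<mu> i) * (z - \<mu> j))\<close> into partial fractions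
  produces the Hamiltonians as residues.
\<close>
lemma hamiltonian_generating_function:
  fixes \<mu> :: "'n::finite \<Rightarrow> complex"
  assumes "inj \<mu>" and z: "z \<notin> range \<mu>"
  shows "(\<Sum>i\<in>UNIV. (x $ i)\<^sup>2 / (z - \<mu> i)) * (\<Sum>i\<in>UNIV. (y $ i)\<^sup>2 / (z - \<mu> i))
      - (\<Sum>i\<in>UNIV. x $ i * y $ i / (z - \<mu> i))\<^sup>2 = (\<Sum>i\<in>UNIV. hamiltonian \<mu> i x y / (z - \<mu> i))"
    (is "?A * ?C - ?B\<^sup>2 = ?H")
proof -
  define u where "u i = 1 / (z - \<mu> i)" for i
  define W where "W i j = (x $ i * y $ j - x $ j * y $ i)\<^sup>2" for i j
  have ne: "z - \<mu> i \<noteq> 0" for i using z by auto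
  have A: "?A = (\<Sum>i\<in>UNIV. (x $ i)\<^sup>2 * u i)" and C: "?C = (\<Sum>i\<in>UNIV. (y $ i)\<^sup>2 * u i)"
    and B: "?B = (\<Sum>i\<in>UNIV. x $ i * y $ i * u i)"
    and H: "?H = (\<Sum>i\<in>UNIV. hamiltonian \<mu> i x y * u i)"
    by (simp_all add: u_def)
  have "?A * ?C + ?A * ?C - 2 * ?B\<^sup>2 =
      (\<Sum>i\<in>UNIV. \<Sum>j\<in>UNIV. (x $ i)\<^sup>2 * u i * ((y $ j)\<^sup>2 * u j))
      + (\<Sum>i\<in>UNIV. \<Sum>j\<in>UNIV. (x $ j)\<^sup>2 * u j * ((y $ i)\<^sup>2 * u i))
      - 2 * (\<Sum>i\<in>UNIV. \<Sum>j\<in>UNIV. x $ i * y $ i * u i * (x $ j * y $ j * u j))"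
    unfolding A B C power2_eq_square[of "sum _ _"] sum_product
    by (subst (2) sum.swap) (rule refl)
  also have "\<dots> = (\<Sum>i\<in>UNIV. \<Sum>j\<in>UNIV. W i j * (u i * u j))"
    unfolding sum_distrib_left sum.distrib[symmetric] sum_subtractf[symmetric] W_def
    by (intro sum.cong refl) (simp add: power2_eq_square algebra_simps)
  also have "\<dots> = (\<Sum>i\<in>UNIV. \<Sum>j\<in>UNIV. W i j / (\<mu> i - \<mu> j) * u i)
      + (\<Sum>i\<in>UNIV. \<Sum>j\<in>UNIV. W j i / (\<mu> j - \<mu> i) * u j)"
    unfolding sum.distrib[symmetric]
  proof (intro sum.cong refl)
    fix i j
    show "W i j * (u i * u j) = W i j / (\<mu> i - \<mu> j) * u i + W j i / (\<mu> j - \<mu> i) * u j"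
    proof (cases "i = j")
      case False
      hence d: "\<mu> i - \<mu> j \<noteq> 0" using assms(1) by (auto dest: injD)
      have sym: "W j i / (\<mu> j - \<mu> i) = - (W i j / (\<mu> i - \<mu> j))"
        using d by (simp add: W_def field_simps power2_eq_square)
      have "u i - u j = (\<mu> i - \<mu> j) * (u i * u j)"
        using ne by (simp add: u_def diff_frac_eq)
      hence pf: "u i * u j = (u i - u j) / (\<mu> i - \<mu> j)"
        using d by simp
      show ?thesis unfolding sym pf by (simp add: algebra_simps diff_divide_distrib)
    qed (simp add: W_def)
  qed
  also have "(\<Sum>i\<in>UNIV. \<Sum>j\<in>UNIV. W j i / (\<mu> j - \<mu> i) * u j)
      = (\<Sum>i\<in>UNIV. \<Sum>j\<in>UNIV. W i j / (\<mu> i - \<mu> j) * u i)"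
    by (rule sum.swap)
  also have "(\<Sum>i\<in>UNIV. \<Sum>j\<in>UNIV. W i j / (\<mu> i - \<mu> j) * u i) = ?H"
  proof -
    have "hamiltonian \<mu> i x y = (\<Sum>j\<in>UNIV. W i j / (\<mu> i - \<mu> j))" for i
      unfolding hamiltonian_def W_def by (rule sum.mono_neutral_left) auto
    thus ?thesis unfolding H by (simp only: sum_distrib_right)
  qed
  finally have "2 * (?A * ?C - ?B\<^sup>2) = 2 * ?H" by (simp only: right_diff_distrib mult_2)
  thus ?thesis by (rule mult_left_cancel[OF zero_neq_numeral[symmetric], THEN iffD1])
qed

lemma hamiltonians_zero_imp_square:
  fixes \<mu> :: "'n::finite \<Rightarrow> complex"
  assumes "inj \<mu>" and "\<And>i. hamiltonian \<mu> i x y = 0"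
  shows "point_poly \<mu> x * lagrange_comb \<mu> (\<lambda>i. (y $ i)\<^sup>2)
      = (lagrange_comb \<mu> (\<lambda>i. x $ i * y $ i))\<^sup>2" (is "?l = ?r")
proof (rule ccontr)
  assume "?l \<noteq> ?r"
  hence "finite {z. poly (?l - ?r) z = 0}" by (intro poly_roots_finite) simp
  moreover have "- range \<mu> \<subseteq> {z. poly (?l - ?r) z = 0}"
  proof
    fix z assume "z \<in> - range \<mu>"
    hence z: "z \<notin> range \<mu>" by simp
    from hamiltonian_generating_function[OF assms(1) z, of x y] assms(2)
    have "(\<Sum>i\<in>UNIV. (x $ i)\<^sup>2 / (z - \<mu> i)) * (\<Sum>i\<in>UNIV. (y $ i)\<^sup>2 / (z - \<mu> i))
      = (\<Sum>i\<in>UNIV. x $ i * y $ i / (z - \<mu> i))\<^sup>2" by simp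
    thus "z \<in> {z. poly (?l - ?r) z = 0}"
      by (simp add: point_poly_eq poly_lagrange_comb_off_nodes[OF z] power_mult_distrib)
         (simp add: power2_eq_square algebra_simps)
  qed
  ultimately have "finite (- range \<mu>)" by (rule rev_finite_subset)
  hence "finite (UNIV :: complex set)" using finite_compl[of "range \<mu>"] by simp
  thus False using infinite_UNIV_char_0 by blast
qed

section \<open>Distinct roots imply very stable\<close>

lemma prod_linear_dvd_if_roots:
  fixes q :: "'a::field poly"
  assumes "finite A" and "\<And>z. z \<in> A \<Longrightarrow> poly q z = 0"
  shows "(\<Prod>z\<in>A. [:- z, 1:]) dvd q"
  using assms
proof (induction A arbitrary: q rule: finite_induct)
  case (insert a A)
  from insert.prems obtain r where r: "q = [:- a, 1:] * r"
    by (metis dvdE insertI1 poly_eq_0_iff_dvd)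
  have "poly r z = 0" if "z \<in> A" for z
    using insert.prems[of z] insert.hyps(2) that by (auto simp: r)
  hence "(\<Prod>z\<in>A. [:- z, 1:]) dvd r" by (rule insert.IH)
  thus ?case unfolding prod.insert[OF insert.hyps] r by (rule mult_dvd_mono[OF dvd_refl])
qed simp

lemma rsquarefree_dvd_square_imp_dvd:
  fixes p q :: "complex poly"
  assumes "rsquarefree p" and "p dvd q\<^sup>2"
  shows "p dvd q"
proof -
  have p: "p \<noteq> 0" using assms(1) by (simp add: rsquarefree_def)
  obtain r where r: "q\<^sup>2 = p * r" using assms(2) by (rule dvdE)
  have "poly q z = 0" if "poly p z = 0" for z
    using arg_cong[OF r, of "\<lambda>f. poly f z"] that by simp
  hence "(\<Prod>z | poly p z = 0. [:- z, 1:]) dvd q"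
    using p by (intro prod_linear_dvd_if_roots poly_roots_finite) auto
  thus ?thesis
    using p by (subst complex_poly_decompose_rsquarefree[OF assms(1), symmetric])
      (simp add: smult_dvd_iff)
qed

text \<open>
  The Hamiltonians vanish, so \<open>p * r = q\<^sup>2\<close>.  A square-free \<open>p\<close> dividing the square of \<open>q\<close> divides
  \<open>q\<close>, say \<open>q = p * g\<close>, so that \<open>r = p * g\<^sup>2\<close>.  The degree of \<open>r\<close> is at most \<open>N - 1\<close>, while the simple zero allowed at
  infinity still leaves \<open>p\<close> of degree at least \<open>N - 4\<close>; so \<open>g\<close> has degree at most one, and its values
  at the nodes are the factors by which \<open>y\<close> differs from \<open>x\<close>.
\<close>
lemma distinct_roots_imp_null:
  fixes \<mu> :: "'n::finite \<Rightarrow> complex"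
  assumes N: "CARD('n) \<ge> 4" and inj: "inj \<mu>"
    and dist: "distinct_roots_P1 (CARD('n) - 3) (point_poly \<mu> x)"
    and ham: "\<And>i. hamiltonian \<mu> i x y = 0"
  shows "y \<in> cotangent_null \<mu> x"
proof -
  define p where "p = point_poly \<mu> x"
  define q where "q = lagrange_comb \<mu> (\<lambda>i. x $ i * y $ i)"
  define r where "r = lagrange_comb \<mu> (\<lambda>i. (y $ i)\<^sup>2)"
  have p0: "p \<noteq> 0" and mult: "zero_mult (CARD('n) - 3) p w \<le> 1" for w
    using dist by (auto simp: distinct_roots_P1_def p_def)
  have degp: "CARD('n) - 4 \<le> degree p"
    using mult[of None] by (simp add: zero_mult_def)
  have sq: "rsquarefree p"
    unfolding rsquarefree_def
  proof (intro conjI allI p0)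
    show "order z p = 0 \<or> order z p = 1" for z
      using mult[of "Some z"] by (auto simp: zero_mult_def)
  qed
  have pr: "p * r = q\<^sup>2"
    unfolding p_def q_def r_def by (rule hamiltonians_zero_imp_square[OF inj ham])
  have "p dvd q"
    by (rule rsquarefree_dvd_square_imp_dvd[OF sq]) (simp flip: pr)
  then obtain g where q: "q = p * g" by (rule dvdE)
  have "p * r = p * (p * g\<^sup>2)" unfolding pr q by (simp add: power2_eq_square ac_simps)
  hence r: "r = p * g\<^sup>2" using p0 by simp
  have "degree g \<le> 1"
  proof (cases "g = 0")
    case False
    hence "degree r = degree p + 2 * degree g"
      using p0 by (simp add: r degree_mult_eq degree_power_eq)
    moreover have "degree r \<le> CARD('n) - 1" unfolding r_def by (rule degree_lagrange_comb)
    ultimately show ?thesis using degp N by linarith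
  qed simp
  define a b where "a = coeff g 0" and "b = coeff g 1"
  have g: "g = [:a, b:]"
    using \<open>degree g \<le> 1\<close>
    by (intro poly_eqI) (auto simp: a_def b_def coeff_pCons coeff_eq_0 split: nat.splits)
  have "y $ i = (a + b * \<mu> i) * x $ i" for i
  proof -
    have w: "node_weight \<mu> i \<noteq> 0" using inj by (rule node_weight_nonzero)
    have p_i: "poly p (\<mu> i) = (x $ i)\<^sup>2 * node_weight \<mu> i"
      by (simp add: p_def poly_point_poly_node)
    have "poly q (\<mu> i) = x $ i * y $ i * node_weight \<mu> i"
      by (simp add: q_def poly_lagrange_comb_node)
    hence "(x $ i * y $ i) * node_weight \<mu> i
        = ((x $ i)\<^sup>2 * (a + b * \<mu> i)) * node_weight \<mu> i"
      by (simp only: q g p_i poly_mult) (simp add: algebra_simps)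
    hence 1: "x $ i * y $ i = (x $ i)\<^sup>2 * (a + b * \<mu> i)"
      by (rule mult_right_cancel[OF w, THEN iffD1])
    have "poly r (\<mu> i) = (y $ i)\<^sup>2 * node_weight \<mu> i"
      by (simp add: r_def poly_lagrange_comb_node)
    hence "(y $ i)\<^sup>2 * node_weight \<mu> i
        = ((x $ i)\<^sup>2 * (a + b * \<mu> i)\<^sup>2) * node_weight \<mu> i"
      by (simp only: r g p_i poly_mult poly_power) (auto simp: algebra_simps)
    hence 2: "(y $ i)\<^sup>2 = (x $ i)\<^sup>2 * (a + b * \<mu> i)\<^sup>2"
      by (rule mult_right_cancel[OF w, THEN iffD1])
    \<comment> \<open>If \<open>x $ i = 0\<close> then \<open>q\<close> carries no information about \<open>y $ i\<close>, but \<open>r\<close> does.\<close>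
    show ?thesis
      using 1 2 by (cases "x $ i = 0") (auto simp: power2_eq_square)
  qed
  thus ?thesis by (auto simp: cotangent_null_iff vec_eq_iff)
qed

section \<open>Multiple roots give nilpotent cotangent vectors\<close>

lemma hamiltonian_full_sum:
  "hamiltonian \<mu> i x y = (\<Sum>j\<in>UNIV. (x $ i * y $ j - x $ j * y $ i)\<^sup>2 / (\<mu> i - \<mu> j))"
  unfolding hamiltonian_def by (rule sum.mono_neutral_left) auto

text \<open>
  Write \<open>p = (z - z0)\<^sup>2 * s\<close>.  Then \<open>s\<close> has degree at most \<open>N - 5\<close> and
  \<open>(x i)\<^sup>2 = (\<mu> i - z0)\<^sup>2 * s (\<mu> i) / w i\<close> with the node weights \<open>w\<close>.  So one can choose \<open>y\<close>
  with \<open>x i = (\<mu> i - z0) * y i\<close> and \<open>(y i)\<^sup>2 = s (\<mu> i) / w i\<close>; in the case \<open>\<mu> i = z0\<close> the second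
  equation alone determines \<open>y i\<close> up to sign.  Since \<open>x i * y j - x j * y i = (\<mu> i - \<mu> j) * y i * y j\<close>,
  every Hamiltonian becomes a sum of values of a polynomial of low degree over the node weights.
\<close>
lemma double_root_imp_not_very_stable:
  fixes \<mu> :: "'n::finite \<Rightarrow> complex"
  assumes N: "CARD('n) \<ge> 4" and inj: "inj \<mu>" and x: "x \<in> quadric_intersection \<mu>"
    and root: "[:- z0, 1:]\<^sup>2 dvd point_poly \<mu> x"
  shows "\<not> very_stable \<mu> x"
proof -
  obtain s where s: "point_poly \<mu> x = [:- z0, 1:]\<^sup>2 * s" using root by (rule dvdE)
  have s0: "s \<noteq> 0" using point_poly_nonzero[OF inj x] s by auto
  have w: "node_weight \<mu> i \<noteq> 0" for i using inj by (rule node_weight_nonzero)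
  have degs: "degree s + 2 \<le> CARD('n) - 3"
    using degree_point_poly[OF x] s0 by (simp add: s degree_mult_eq degree_power_eq)
  define y :: "complex ^ 'n" where
    "y = (\<chi> i. if \<mu> i = z0 then csqrt (poly s (\<mu> i) / node_weight \<mu> i) else x $ i / (\<mu> i - z0))"
  have x2: "(x $ i)\<^sup>2 * node_weight \<mu> i = (\<mu> i - z0)\<^sup>2 * poly s (\<mu> i)" for i
    using poly_point_poly_node[of \<mu> x i] by (simp add: s)
  have xy: "x $ i = (\<mu> i - z0) * y $ i" for i
    using x2[of i] w[of i] by (auto simp: y_def)
  have y2: "(y $ i)\<^sup>2 = poly s (\<mu> i) / node_weight \<mu> i" for i
  proof (cases "\<mu> i = z0")
    case False
    thus ?thesis using x2[of i] w[of i] by (simp add: y_def field_simps)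
  qed (simp add: y_def)
  have sum0: "(\<Sum>j\<in>UNIV. poly [:a, b:] (\<mu> j) * (y $ j)\<^sup>2) = 0" for a b
  proof -
    have "degree ([:a, b:] * s) + 1 < CARD('n)"
      using degree_mult_le[of "[:a, b:]" s] degree_pCons_le[of a "[:b:]"] degs N
      by (simp del: mult_pCons_left)
    from sum_values_over_node_weights[OF inj this] show ?thesis
      by (simp add: y2 algebra_simps add_divide_distrib)
  qed
  have "(\<Sum>i\<in>UNIV. x $ i * y $ i) = 0"
    using sum0[of "- z0" 1] by (simp add: xy power2_eq_square algebra_simps)
  moreover have "hamiltonian \<mu> i x y = 0" for i
  proof -
    have "(x $ i * y $ j - x $ j * y $ i)\<^sup>2 / (\<mu> i - \<mu> j)
        = (y $ i)\<^sup>2 * (poly [:\<mu> i, - 1:] (\<mu> j) * (y $ j)\<^sup>2)" for j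
    proof -
      have "x $ i * y $ j - x $ j * y $ i = (\<mu> i - \<mu> j) * (y $ i * y $ j)"
        by (simp add: xy algebra_simps)
      thus ?thesis by (simp add: power2_eq_square)
    qed
    hence "hamiltonian \<mu> i x y = (y $ i)\<^sup>2 * (\<Sum>j\<in>UNIV. poly [:\<mu> i, - 1:] (\<mu> j) * (y $ j)\<^sup>2)"
      by (simp only: hamiltonian_full_sum sum_distrib_left)
    thus ?thesis by (simp only: sum0 mult_zero_right)
  qed
  moreover have "y \<notin> cotangent_null \<mu> x"
  proof
    assume "y \<in> cotangent_null \<mu> x"
    then obtain a b where "y = (\<chi> i. (a + b * \<mu> i) * x $ i)"
      by (auto simp only: cotangent_null_iff)
    hence ab: "y $ i = (a + b * \<mu> i) * x $ i" for i by simp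
    \<comment> \<open>Eliminating \<open>x\<close> from \<open>ab\<close> and \<open>xy\<close> yields a relation in which only \<open>y i\<close> remains.\<close>
    define g where "g = [:1:] - [:a, b:] * [:- z0, 1:]"
    have "poly g (\<mu> i) * y $ i = 0" for i
      using ab[of i] xy[of i] by (simp add: g_def algebra_simps)
    hence zero: "poly g (\<mu> i) * x $ i = 0" for i
      unfolding xy[of i] by auto
    have "degree g \<le> 2"
      unfolding g_def by (auto intro!: degree_diff_le)
    hence "g = 0" using quadratic_multiplier_zero[OF N inj x _ zero] by blast
    moreover have "poly g z0 = 1" by (simp add: g_def)
    ultimately show False by simp
  qed
  ultimately show ?thesis by (auto simp: very_stable_def cotangent_reps_def)
qed

text \<open>
  The low degree of \<open>p\<close> says that the moments \<open>\<Sum>i. (\<mu> i)^k * (x i)\<^sup>2\<close> vanish for \<open>k \<le> 3\<close>.  The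
  vector to take is \<open>y i = (\<mu> i)\<^sup>2 * x i\<close>: it is the limit, modulo the null directions, of suitably
  rescaled vectors \<open>x i / (\<mu> i - z0)\<close> as \<open>z0\<close> tends to infinity.
\<close>
lemma double_root_at_infinity_imp_not_very_stable:
  fixes \<mu> :: "'n::finite \<Rightarrow> complex"
  assumes N: "CARD('n) \<ge> 4" and inj: "inj \<mu>" and x: "x \<in> quadric_intersection \<mu>"
    and deg: "degree (point_poly \<mu> x) + 2 \<le> CARD('n) - 3"
  shows "\<not> very_stable \<mu> x"
proof -
  define y :: "complex ^ 'n" where "y = (\<chi> i. (\<mu> i)\<^sup>2 * x $ i)"
  have w: "node_weight \<mu> i \<noteq> 0" for i using inj by (rule node_weight_nonzero)
  have sum0: "(\<Sum>j\<in>UNIV. poly h (\<mu> j) * (x $ j)\<^sup>2) = 0" if "degree h \<le> 3" for h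
  proof -
    have "degree (h * point_poly \<mu> x) + 1 < CARD('n)"
      using degree_mult_le[of h "point_poly \<mu> x"] deg that N by linarith
    from sum_values_over_node_weights[OF inj this] show ?thesis
      using w by (simp add: poly_point_poly_node)
  qed
  have "(\<Sum>i\<in>UNIV. x $ i * y $ i) = 0"
    using sum0[of "[:0, 0, 1:]"] by (simp add: y_def power2_eq_square algebra_simps)
  moreover have "hamiltonian \<mu> i x y = 0" for i
  proof -
    define h where "h = [:\<mu> i, - 1:] * [:\<mu> i, 1:] * [:\<mu> i, 1:]"
    have "(x $ i * y $ j - x $ j * y $ i)\<^sup>2 / (\<mu> i - \<mu> j) = (x $ i)\<^sup>2 * (poly h (\<mu> j) * (x $ j)\<^sup>2)" for j
    proof -
      have "(x $ i * y $ j - x $ j * y $ i)\<^sup>2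
          = (\<mu> i - \<mu> j) * ((\<mu> i - \<mu> j) * (\<mu> i + \<mu> j)\<^sup>2 * ((x $ i)\<^sup>2 * (x $ j)\<^sup>2))"
        by (simp add: y_def power2_eq_square algebra_simps)
      moreover have "poly h (\<mu> j) = (\<mu> i - \<mu> j) * (\<mu> i + \<mu> j)\<^sup>2"
        by (simp add: h_def power2_eq_square algebra_simps)
      ultimately show ?thesis by simp
    qed
    hence "hamiltonian \<mu> i x y = (x $ i)\<^sup>2 * (\<Sum>j\<in>UNIV. poly h (\<mu> j) * (x $ j)\<^sup>2)"
      by (simp only: hamiltonian_full_sum sum_distrib_left)
    moreover have "degree h \<le> 3" by (simp add: h_def degree_mult_eq)
    ultimately show ?thesis by (simp add: sum0)
  qed
  moreover have "y \<notin> cotangent_null \<mu> x"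
  proof
    assume "y \<in> cotangent_null \<mu> x"
    then obtain a b where "y = (\<chi> i. (a + b * \<mu> i) * x $ i)"
      by (auto simp only: cotangent_null_iff)
    hence ab: "y $ i = (a + b * \<mu> i) * x $ i" for i by simp
    have "poly [:- a, - b, 1:] (\<mu> i) * x $ i = 0" for i
      using ab[of i] by (simp add: y_def power2_eq_square algebra_simps)
    from quadratic_multiplier_zero[OF N inj x _ this] show False by simp
  qed
  ultimately show ?thesis by (auto simp: very_stable_def cotangent_reps_def)
qed

section \<open>The criterion\<close>

theorem proposition1:
  fixes \<mu> :: "'n::finite \<Rightarrow> complex" and x :: "complex ^ 'n"
  assumes "CARD('n) \<ge> 4"
    and "inj \<mu>"
    and "x \<in> quadric_intersection \<mu>"
  shows "very_stable \<mu> x \<longleftrightarrow> distinct_roots_P1 (CARD('n) - 3) (point_poly \<mu> x)"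
proof
  assume vs: "very_stable \<mu> x"
  have "zero_mult (CARD('n) - 3) (point_poly \<mu> x) w \<le> 1" for w
  proof (rule ccontr)
    assume bad: "\<not> zero_mult (CARD('n) - 3) (point_poly \<mu> x) w \<le> 1"
    show False
    proof (cases w)
      case None
      with bad have "degree (point_poly \<mu> x) + 2 \<le> CARD('n) - 3"
        by (simp add: zero_mult_def)
      with double_root_at_infinity_imp_not_very_stable[OF assms] vs show False by blast
    next
      case (Some z)
      with bad have "[:- z, 1:]\<^sup>2 dvd point_poly \<mu> x"
        by (simp add: zero_mult_def order_divides)
      with double_root_imp_not_very_stable[OF assms] vs show False by blast
    qed
  qed
  thus "distinct_roots_P1 (CARD('n) - 3) (point_poly \<mu> x)"
    using point_poly_nonzero[OF assms(2,3)] degree_point_poly[OF assms(3)]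
    by (simp add: distinct_roots_P1_def)
next
  assume "distinct_roots_P1 (CARD('n) - 3) (point_poly \<mu> x)"
  from distinct_roots_imp_null[OF assms(1,2) this] show "very_stable \<mu> x"
    by (auto simp: very_stable_def)
qed

end
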